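(* Let $K$ be a perfect field and let $L/K$ be a nontrivial finite extension. Suppose that one of the fields in the unique descending chain of $L/K$ which is different from both $L$ and $K$ coincides with one of the fields in the unique ascending chain of $L/K$. Then $L/K$ is primitive.
   Context: Fix an algebraic closure $\bar K$ of the perfect field $K$; all extensions are finite and contained in $\bar K$. $\tilde L$ denotes the Galois closure of $L/K$ in $\bar K$. Unique chains: for a nontrivial finite extension $L/K$, the unique descending chain of $L/K$ is the unique strictly descending chain of subextensions $L=N_0\supsetneq N_1\supsetneq\dots\supsetneq N_k$ such that for all $1\le i\le k$, $N_i$ is the unique intermediate field of $N_{i-1}/K$ such that $N_{i-1}/N_i$ is Galois of maximum possible degree. The unique ascending chain of $L/K$ is the unique strictly ascending chain of subextensions $K=F_0\subsetneq F_1\subsetneq\dots\subsetneq F_l$ such that for all $1\le j\le l$, $F_j$ is the unique intermediate field of $L/F_{j-1}$ such that $F_j/F_{j-1}$ is Galois of maximum possible degree. Each chain is continued as long as it can be strictly continued; both terminate since $L/K$ is finite (the descending chain need not reach $K$ and the ascending chain need not reach $L$). Strong cluster magnification: a finite extension $M/K$ is obtained by strong cluster magnification from a subextension $L'/K$ if (1) $[L':K]>2$; (2) there exists a finite Galois extension $F/K$ such that the Galois closure $\tilde{L'}$ of $L'/K$ and $F$ are linearly disjoint over $K$ (i.e. $\tilde{L'}\cap F=K$); (3) $L'F=M$. It is trivial if $[F:K]=1$ and nontrivial otherwise. An extension $L/K$ is called primitive if it is not obtained by a nontrivial strong cluster magnification from any subextension over $K$. *)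

theory Defs
  imports "HOL-Algebra.Algebraic_Closure" "HOL-Algebra.Generated_Fields"
begin

text \<open>
  All fields are subfields of one ambient ring \<open>R\<close>, which in applications is an algebraic closure
  of the base field. The degree of \<open>L/K\<close> is \<open>dim K L\<close>, and \<open>roots p\<close> is the multiset of roots of
  \<open>p\<close> in \<open>R\<close>. (The library's \<open>splitted_on\<close> is of no use for relative splitting: it caps
  multiplicities at one and degenerates over infinite subfields.)
\<close>

context ring
begin

definition finite_field_ext :: "'a set \<Rightarrow> 'a set \<Rightarrow> bool"
  where "finite_field_ext K L \<longleftrightarrow>
    subfield K R \<and> subfield L R \<and> K \<subseteq> L \<and> finite_dimension K L"

definition intermediate_field :: "'a set \<Rightarrow> 'a set \<Rightarrow> 'a set \<Rightarrow> bool"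
  where "intermediate_field K L M \<longleftrightarrow> subfield M R \<and> K \<subseteq> M \<and> M \<subseteq> L"

text \<open>Simplicity of the roots is the intended notion only when \<open>p\<close> splits in \<open>R\<close>.\<close>

definition separable_poly :: "'a list \<Rightarrow> bool"
  where "separable_poly p \<longleftrightarrow> (\<forall>x \<in> set_mset (roots p). alg_mult p x = 1)"

definition perfect_field :: "'a set \<Rightarrow> bool"
  where "perfect_field K \<longleftrightarrow>
    subfield K R \<and> (\<forall>p \<in> carrier (K[X]). pirreducible K p \<longrightarrow> separable_poly p)"

definition normal_ext :: "'a set \<Rightarrow> 'a set \<Rightarrow> bool"
  where "normal_ext K L \<longleftrightarrow> (\<forall>x \<in> L. set_mset (roots (Irr K x)) \<subseteq> L)"

definition separable_ext :: "'a set \<Rightarrow> 'a set \<Rightarrow> bool"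
  where "separable_ext K L \<longleftrightarrow> (\<forall>x \<in> L. separable_poly (Irr K x))"

definition galois_ext :: "'a set \<Rightarrow> 'a set \<Rightarrow> bool"
  where "galois_ext K L \<longleftrightarrow> finite_field_ext K L \<and> normal_ext K L \<and> separable_ext K L"

definition galois_closure :: "'a set \<Rightarrow> 'a set \<Rightarrow> 'a set"
  where "galois_closure K L = \<Inter> {E. galois_ext K E \<and> L \<subseteq> E}"

definition compositum :: "'a set \<Rightarrow> 'a set \<Rightarrow> 'a set"
  where "compositum L F = generate_field R (L \<union> F)"

text \<open>
  \<open>descending_step K M N\<close>: \<open>N\<close> is the unique intermediate field of \<open>M/K\<close> such that \<open>M/N\<close> is Galois of
  maximum degree. \<open>ascending_step M L N\<close>: \<open>N\<close> is the unique intermediate field of \<open>L/M\<close> such that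
  \<open>N/M\<close> is Galois of maximum degree.
\<close>

definition descending_step :: "'a set \<Rightarrow> 'a set \<Rightarrow> 'a set \<Rightarrow> bool"
  where "descending_step K M N \<longleftrightarrow>
    (\<forall>E. is_arg_max (\<lambda>E. dim E M) (\<lambda>E. intermediate_field K M E \<and> galois_ext E M) E \<longleftrightarrow> E = N)"

definition ascending_step :: "'a set \<Rightarrow> 'a set \<Rightarrow> 'a set \<Rightarrow> bool"
  where "ascending_step M L N \<longleftrightarrow>
    (\<forall>E. is_arg_max (\<lambda>E. dim M E) (\<lambda>E. intermediate_field M L E \<and> galois_ext M E) E \<longleftrightarrow> E = N)"

text \<open>The last conjunct says that the chain cannot be strictly continued.\<close>

definition unique_descending_chain :: "'a set \<Rightarrow> 'a set \<Rightarrow> 'a set list \<Rightarrow> bool"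
  where "unique_descending_chain K L Ns \<longleftrightarrow>
    Ns \<noteq> [] \<and> hd Ns = L \<and>
    successively (\<lambda>M N. N \<subset> M \<and> descending_step K M N) Ns \<and>
    \<not> (\<exists>N. N \<subset> last Ns \<and> descending_step K (last Ns) N)"

definition unique_ascending_chain :: "'a set \<Rightarrow> 'a set \<Rightarrow> 'a set list \<Rightarrow> bool"
  where "unique_ascending_chain K L Fs \<longleftrightarrow>
    Fs \<noteq> [] \<and> hd Fs = K \<and>
    successively (\<lambda>M N. M \<subset> N \<and> ascending_step M L N) Fs \<and>
    \<not> (\<exists>N. last Fs \<subset> N \<and> ascending_step (last Fs) L N)"

text \<open>
  \<open>M/K\<close> is obtained by strong cluster magnification from the subextension \<open>L'/K\<close> by means of the
  Galois extension \<open>F/K\<close>.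
\<close>

definition strong_cluster_magnification :: "'a set \<Rightarrow> 'a set \<Rightarrow> 'a set \<Rightarrow> 'a set \<Rightarrow> bool"
  where "strong_cluster_magnification K M L' F \<longleftrightarrow>
    intermediate_field K M L' \<and> dim K L' > 2 \<and>
    galois_ext K F \<and> galois_closure K L' \<inter> F = K \<and> compositum L' F = M"

definition primitive_ext :: "'a set \<Rightarrow> 'a set \<Rightarrow> bool"
  where "primitive_ext K L \<longleftrightarrow>
    \<not> (\<exists>L' F. strong_cluster_magnification K L L' F \<and> dim K F \<noteq> 1)"

end

end

theory Submission
  imports Defs
begin

text \<open>
  Suppose that \<open>L\<close> is a strong cluster magnification, so that it is the compositum of an intermediate
  field \<open>E\<close> of \<open>L/K\<close> and a Galois extension \<open>F\<close> of \<open>K\<close> with \<open>F \<inter> E = K\<close>. The chains of \<open>L/K\<close> are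
  squeezed by \<open>E\<close> and \<open>F\<close> already at their first steps, from \<open>L\<close> down to \<open>N\<^sub>1\<close> and from \<open>K\<close> up to \<open>F\<^sub>1\<close>.

  \<^item> \<open>L/E\<close> is Galois, because \<open>L\<close> arises from \<open>E\<close> by adjoining \<open>F\<close>. As \<open>L/N\<^sub>1\<close> is Galois too, so is
    \<open>L/(N\<^sub>1 \<inter> E)\<close>, and maximality of the degree of \<open>L/N\<^sub>1\<close> forces \<open>N\<^sub>1 \<subseteq> E\<close>
    (\<open>descending_step_least\<close>). Hence every field of the descending chain except \<open>L\<close> lies in \<open>E\<close>.
  \<^item> \<open>F/K\<close> is a Galois subextension of \<open>L/K\<close>, and so is its compositum with \<open>F\<^sub>1\<close>; maximality of
    \<open>F\<^sub>1\<close> forces \<open>F \<subseteq> F\<^sub>1\<close> (\<open>ascending_step_greatest\<close>). Hence every field of the ascending chain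
    except \<open>K\<close> contains \<open>F\<close>.

  A field \<open>N\<close> common to both chains and different from \<open>L\<close> and \<open>K\<close> therefore satisfies
  \<open>F \<subseteq> N \<subseteq> E\<close>, which gives \<open>F = K\<close>: the magnification is trivial.

  Two facts of Galois theory carry this. The first is that adjoining a conjugation-closed set
  produces a normal extension (\<open>normal_ext_generated_by_conjugates\<close>); it rests on extending
  embeddings into the algebraically closed ambient field. The second is that if \<open>M\<close> is Galois over two
  fields and finite over their intersection, then it is Galois over the intersection
  (\<open>galois_ext_Int\<close>). Instead of Artin's theorem on fixed fields, its proof uses only
  polynomials: the conjugates of \<open>x\<close> that lie in \<open>M\<close> are the simple roots of one monic polynomial,
  which has coefficients in both bases.
\<close>

section \<open>Finite extensions of subfields\<close>

lemma (in field) subfield_Int: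
  assumes "subfield E R" and "subfield F R"
  shows "subfield (E \<inter> F) R"
proof (rule subfieldI')
  show "subring (E \<inter> F) R"
    using subring_inter[OF subfieldE(1)[OF assms(1)] subfieldE(1)[OF assms(2)]] .
  show "inv k \<in> E \<inter> F" if "k \<in> E \<inter> F - {\<zero>}" for k
    using subfield_m_inv(1)[OF assms(1), of k] subfield_m_inv(1)[OF assms(2), of k] that by blast
qed

lemma (in ring) subalgebra_of_subfield:
  assumes "subfield F R" and "K \<subseteq> F"
  shows "subalgebra K F R"
proof (intro subalgebra.intro subalgebra_axioms.intro)
  show "subgroup F (add_monoid R)"
    using subring.axioms(1)[OF subfieldE(1)[OF assms(1)]] .
  show "k \<otimes> v \<in> F" if "k \<in> K" "v \<in> F" for k v
    using subringE(6)[OF subfieldE(1)[OF assms(1)]] that assms(2) by blast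
qed

lemma (in ring) finite_dimension_subfield:
  assumes "subfield K R" and "finite_dimension K M"
    and "subfield F R" and "K \<subseteq> F" and "F \<subseteq> M"
  shows "finite_dimension K F"
  using subalbegra_incl_imp_finite_dimension[OF assms(1,2) subalgebra_of_subfield] assms(3-5)
  by blast

text \<open>
  A list that spans \<open>M\<close> over \<open>K\<close> spans it over any larger field of scalars.
\<close>

lemma (in ring) finite_dimension_enlarge_base:
  assumes "subfield K R" and "subfield M R" and "finite_dimension K M"
    and "subfield F R" and "K \<subseteq> F" and "F \<subseteq> M"
  shows "finite_dimension F M"
proof -
  obtain Us where Us: "set Us \<subseteq> carrier R" "Span K Us = M"
    using exists_base[OF assms(1) finite_dimensionE[OF assms(1,3)]] by blast
  have "set Us \<subseteq> M"
    using Span_base_incl[OF assms(1) Us(1)] Us(2) by simp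
  then have "Span F Us \<subseteq> M"
    using subalgebra_Span_incl[OF assms(4) subalgebra_of_subfield] assms(2,6) by blast
  moreover have "M \<subseteq> Span F Us"
    using Us(2) assms(5)
    unfolding Span_eq_combine_set[OF assms(1) Us(1)] Span_eq_combine_set[OF assms(4) Us(1)] by blast
  ultimately show ?thesis
    using Span_finite_dimension[OF assms(4) Us(1)] by simp
qed

lemma (in ring) finite_extension_algebraic:
  assumes "subfield K R" and "subfield M R" and "finite_dimension K M" and "x \<in> M"
  shows "algebraic K x"
  using finite_dimension_imp_algebraic[OF assms(1) subfieldE(1)[OF assms(2)] assms(3,4)]
  by (simp add: over_def)

section \<open>Minimal polynomials and conjugates\<close>

lemma (in domain) Irr_props:
  assumes "subfield K R" and "x \<in> carrier R" and "algebraic K x"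
  shows "Irr K x \<in> carrier (K[X])" and "pirreducible K (Irr K x)"
    and "lead_coeff (Irr K x) = \<one>" and "eval (Irr K x) x = \<zero>"
    and "Irr K x \<in> carrier (poly_ring R)" and "Irr K x \<noteq> []"
  using IrrE[OF assms(1,2)] assms(3) carrier_polynomial_shell[OF subfieldE(1)[OF assms(1)]]
    pirreducibleE(1)[OF subfieldE(1)[OF assms(1)]]
  unfolding over_def by blast+

lemma (in domain) roots_Irr_iff:
  assumes "subfield K R" and "x \<in> carrier R" and "algebraic K x"
  shows "y \<in># roots (Irr K x) \<longleftrightarrow> y \<in> carrier R \<and> eval (Irr K x) y = \<zero>"
  using roots_mem_iff_is_root[OF Irr_props(5)[OF assms]] Irr_props(6)[OF assms]
  unfolding is_root_def by blast

lemma (in domain) Irr_conjugate: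
  assumes "subfield K R" and "x \<in> carrier R" and "algebraic K x"
    and "y \<in># roots (Irr K x)"
  shows "algebraic K y" and "Irr K y = Irr K x"
proof -
  have y: "y \<in> carrier R" "eval (Irr K x) y = \<zero>"
    using roots_Irr_iff[OF assms(1-3)] assms(4) by blast+
  show alg: "algebraic K y"
    using algebraicI[OF Irr_props(1,6)[OF assms(1-3)] y(2)] by (simp add: over_def)
  have "(algebraic over K) y" using alg by (simp add: over_def)
  from minimal_polynomial_is_unique[OF assms(1) y(1) this]
  show "Irr K y = Irr K x"
    using Irr_props[OF assms(1-3)] Irr_props[OF assms(1) y(1) alg] y by blast
qed

text \<open>
  Over a larger field the minimal polynomial is a divisor of the old one, so conjugates over \<open>F\<close> are
  conjugates over \<open>K\<close>, with no larger multiplicity.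
\<close>

lemma (in domain) roots_Irr_antimono:
  assumes "subfield K R" and "subfield F R" and "K \<subseteq> F" 
    and "x \<in> carrier R" and "algebraic K x"
  shows "roots (Irr F x) \<subseteq># roots (Irr K x)"
proof -
  have "Irr K x \<in> carrier (F[X])"
    using Irr_props(1)[OF assms(1,4,5)] assms(3)
    unfolding sym[OF univ_poly_carrier] polynomial_def by blast
  moreover have alg: "(algebraic over F) x"
    using algebraic_mono[OF assms(3)] assms(5) by (simp add: over_def)
  ultimately have "Irr F x pdivides Irr K x"
    using Irr_minimal[OF assms(2,4) alg] Irr_props(4)[OF assms(1,4,5)] by blast
  then show ?thesis
    using pdivides_imp_roots_incl Irr_props(5,6)[OF assms(1,4,5)]
      Irr_props(5)[OF assms(2,4)] alg by (simp add: over_def)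
qed

lemma (in domain) separable_poly_iff:
  assumes "p \<in> carrier (poly_ring R)"
  shows "separable_poly p \<longleftrightarrow> (\<forall>x. count (roots p) x \<le> 1)"
  unfolding separable_poly_def alg_mult_eq_count_roots[OF assms]
  by (metis One_nat_def Suc_leI count_eq_zero_iff count_greater_zero_iff le_antisym nat_le_linear zero_le_one)

lemma (in domain) separable_poly_mono:
  assumes "p \<in> carrier (poly_ring R)" "q \<in> carrier (poly_ring R)"
    and "roots p \<subseteq># roots q" and "separable_poly q"
  shows "separable_poly p"
  using assms(3,4) mset_subset_eq_count[OF assms(3)] le_trans
  unfolding separable_poly_iff[OF assms(1)] separable_poly_iff[OF assms(2)] by blast

text \<open>
  Perfectness of \<open>K\<close> settles separability over every field between \<open>K\<close> and \<open>M\<close>, so that being Galois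
  over such a field reduces to being normal over it.
\<close>

lemma (in domain) perfect_field_separable_ext:
  assumes "perfect_field K" and "subfield M R" and "finite_dimension K M"
    and "subfield F R" and "K \<subseteq> F" and "F \<subseteq> M"
  shows "separable_ext F M"
  unfolding separable_ext_def
proof
  fix x assume x: "x \<in> M"
  have K: "subfield K R" using assms(1) unfolding perfect_field_def by blast
  have xc: "x \<in> carrier R" using x subfieldE(3)[OF assms(2)] by blast
  have alg: "algebraic K x" using finite_extension_algebraic[OF K assms(2,3) x] .
  have algF: "algebraic F x" using algebraic_mono[OF assms(5)] alg by (simp add: over_def)
  show "separable_poly (Irr F x)"
    using separable_poly_mono[OF Irr_props(5)[OF assms(4) xc algF] Irr_props(5)[OF K xc alg]
        roots_Irr_antimono[OF K assms(4,5) xc alg]]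
      Irr_props(1,2)[OF K xc alg] assms(1) unfolding perfect_field_def by blast
qed

section \<open>Extension of embeddings\<close>

lemma (in domain) poly_eval_hom:
  assumes "subring A R" and "f \<in> ring_hom (R\<lparr>carrier := A\<rparr>) R" and "y \<in> carrier R"
  shows "(\<lambda>p. eval (map f p) y) \<in> ring_hom (A[X]) R"
proof -
  interpret h: ring_hom_ring "R\<lparr>carrier := A\<rparr>" R f
    using ring_hom_ringI2[OF subring_is_ring[OF assms(1)] ring_axioms assms(2)] .
  have A: "set p \<subseteq> A" if "p \<in> carrier (A[X])" for p
    using that unfolding sym[OF univ_poly_carrier] polynomial_def by auto
  have B: "set (map f p) \<subseteq> carrier R" if "p \<in> carrier (A[X])" for p
    using A[OF that] h.hom_closed by auto
  show ?thesis
  proof (rule ring_hom_memI)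
    fix p assume p: "p \<in> carrier (A[X])"
    show "eval (map f p) y \<in> carrier R"
      using eval_in_carrier[OF B[OF p] assms(3)] .
    fix q assume q: "q \<in> carrier (A[X])"
    have pc: "p \<otimes>\<^bsub>A[X]\<^esub> q \<in> carrier (A[X])" "p \<oplus>\<^bsub>A[X]\<^esub> q \<in> carrier (A[X])"
      using ring.ring_simprules(1,5)[OF univ_poly_is_ring[OF assms(1)]] p q by blast+
    have "eval (map f (p \<otimes>\<^bsub>A[X]\<^esub> q)) y = eval (normalize (map f (p \<otimes>\<^bsub>A[X]\<^esub> q))) y"
      using eval_normalize[OF B[OF pc(1)] assms(3)] by simp
    also have "normalize (map f (p \<otimes>\<^bsub>A[X]\<^esub> q)) = poly_mult (map f p) (map f q)"
      using h.poly_mult_hom'[of p q] A[OF p] A[OF q] poly_mult_consistent[OF assms(1)]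
      by (simp add: univ_poly_mult)
    finally show "eval (map f (p \<otimes>\<^bsub>A[X]\<^esub> q)) y = eval (map f p) y \<otimes> eval (map f q) y"
      using eval_poly_mult[OF B[OF p] B[OF q] assms(3)] by simp
    have "eval (map f (p \<oplus>\<^bsub>A[X]\<^esub> q)) y = eval (normalize (map f (p \<oplus>\<^bsub>A[X]\<^esub> q))) y"
      using eval_normalize[OF B[OF pc(2)] assms(3)] by simp
    also have "normalize (map f (p \<oplus>\<^bsub>A[X]\<^esub> q)) = poly_add (map f p) (map f q)"
      using h.poly_add_hom'[of p q] A[OF p] A[OF q] poly_add_consistent[OF assms(1)]
      by (simp add: univ_poly_add)
    finally show "eval (map f (p \<oplus>\<^bsub>A[X]\<^esub> q)) y = eval (map f p) y \<oplus> eval (map f q) y"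
      using eval_poly_add[OF B[OF p] B[OF q] assms(3)] by simp
  next
    show "eval (map f \<one>\<^bsub>A[X]\<^esub>) y = \<one>"
      using h.hom_one assms(3) by (simp add: univ_poly_one)
  qed
qed

text \<open>
  The rule \<open>p(x) \<mapsto> (f p)(y)\<close> is well defined: if \<open>p(x) = 0\<close>, then \<open>p\<close> is a multiple of the minimal
  polynomial of \<open>x\<close>, whose image under \<open>f\<close> vanishes at \<open>y\<close>.
\<close>

lemma (in domain) extend_hom_to_simple_extension:
  assumes A: "subfield A R" and hom: "f \<in> ring_hom (R\<lparr>carrier := A\<rparr>) R"
    and x: "x \<in> carrier R" "algebraic A x"
    and y: "y \<in> carrier R" "eval (map f (Irr A x)) y = \<zero>"
  obtains g where "g \<in> ring_hom (R\<lparr>carrier := simple_extension A x\<rparr>) R"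
    and "\<And>a. a \<in> A \<Longrightarrow> g a = f a" and "g x = y"
proof -
  note sub = subfieldE(1)[OF A]
  interpret UP: domain "A[X]" using univ_poly_is_domain[OF sub] .
  let ?\<phi> = "\<lambda>p. eval (map f p) y"
  interpret h: ring_hom_ring "R\<lparr>carrier := A\<rparr>" R f
    using ring_hom_ringI2[OF subring_is_ring[OF sub] ring_axioms hom] .
  interpret phi: ring_hom_ring "A[X]" R ?\<phi>
    using ring_hom_ringI2[OF UP.ring_axioms ring_axioms poly_eval_hom[OF sub hom y(1)]] .
  interpret psi: ring_hom_ring "A[X]" R "\<lambda>p. eval p x"
    using eval_ring_hom[OF sub x(1)] .
  have ker: "?\<phi> p = \<zero>" if p: "p \<in> carrier (A[X])" "eval p x = \<zero>" for p
  proof -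
    have dvd: "Irr A x pdivides p"
      using Irr_minimal[OF A x(1) _ p] x(2) by (simp add: over_def)
    obtain q where "q \<in> carrier (A[X])" "p = Irr A x \<otimes>\<^bsub>A[X]\<^esub> q"
      using pdivides_iff_shell[OF A Irr_props(1)[OF A x] p(1)] dvd unfolding factor_def by blast
    then show ?thesis
      using phi.hom_mult[OF Irr_props(1)[OF A x]] y phi.hom_closed by simp
  qed
  have wd: "?\<phi> p = ?\<phi> q"
    if "p \<in> carrier (A[X])" "q \<in> carrier (A[X])" "eval p x = eval q x" for p q
  proof -
    have "eval (p \<ominus>\<^bsub>A[X]\<^esub> q) x = \<zero>"
      using that psi.hom_closed by (simp add: a_minus_def r_neg)
    then have "?\<phi> (p \<ominus>\<^bsub>A[X]\<^esub> q) = \<zero>"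
      using ker[OF UP.minus_closed[OF that(1,2)]] by blast
    then have "?\<phi> p \<ominus> ?\<phi> q = \<zero>"
      using that by (simp add: a_minus_def)
    then show ?thesis
      using phi.hom_closed[OF that(1)] phi.hom_closed[OF that(2)] r_right_minus_eq by simp
  qed
  let ?B = "simple_extension A x"
  \<comment> \<open>Any polynomial that represents \<open>z\<close> may be chosen, because \<open>wd\<close> makes the value independent of it.\<close>
  define g where "g z = ?\<phi> (SOME p. p \<in> carrier (A[X]) \<and> eval p x = z)" for z
  have tau: "g (eval p x) = ?\<phi> p" if "p \<in> carrier (A[X])" for p
  proof -
    have "(SOME q. q \<in> carrier (A[X]) \<and> eval q x = eval p x) \<in> carrier (A[X]) \<and>
        eval (SOME q. q \<in> carrier (A[X]) \<and> eval q x = eval p x) x = eval p x"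
      using someI[of "\<lambda>q. q \<in> carrier (A[X]) \<and> eval q x = eval p x" p] that by blast
    then show ?thesis
      using wd that unfolding g_def by blast
  qed
  have B: "?B = (\<lambda>p. eval p x) ` carrier (A[X])"
    using simple_extension_as_eval_img[OF subfieldE(3)[OF A] x(1)] .
  show thesis
  proof
    show "g \<in> ring_hom (R\<lparr>carrier := ?B\<rparr>) R"
    proof (rule ring_hom_memI)
      fix u assume "u \<in> carrier (R\<lparr>carrier := ?B\<rparr>)"
      then obtain p where p: "p \<in> carrier (A[X])" "u = eval p x" using B by auto
      then show "g u \<in> carrier R" using tau phi.hom_closed by simp
      fix v assume "v \<in> carrier (R\<lparr>carrier := ?B\<rparr>)"
      then obtain q where q: "q \<in> carrier (A[X])" "v = eval q x" using B by auto
      have "g (u \<otimes> v) = g u \<otimes> g v"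
        using tau[of "p \<otimes>\<^bsub>A[X]\<^esub> q"] p q tau by simp
      then show "g (u \<otimes>\<^bsub>R\<lparr>carrier := ?B\<rparr>\<^esub> v) = g u \<otimes> g v" by simp
      have "g (u \<oplus> v) = g u \<oplus> g v"
        using tau[of "p \<oplus>\<^bsub>A[X]\<^esub> q"] p q tau by simp
      then show "g (u \<oplus>\<^bsub>R\<lparr>carrier := ?B\<rparr>\<^esub> v) = g u \<oplus> g v" by simp
    next
      show "g \<one>\<^bsub>R\<lparr>carrier := ?B\<rparr>\<^esub> = \<one>"
        using tau[of "\<one>\<^bsub>A[X]\<^esub>"] psi.hom_one phi.hom_one by simp
    qed
  next
    fix a assume a: "a \<in> A"
    have ac: "a \<in> carrier R" using a subfieldE(3)[OF A] by blast
    show "g a = f a"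
    proof (cases "a = \<zero>")
      case True
      then show ?thesis
        using tau[of "\<zero>\<^bsub>A[X]\<^esub>"] psi.hom_zero phi.hom_zero h.hom_zero by simp
    next
      case False
      then have "[a] \<in> carrier (A[X])"
        using a unfolding sym[OF univ_poly_carrier] polynomial_def by simp
      then show ?thesis
        using tau[of "[a]"] ac x(1) y(1) h.hom_closed[of a] a by simp
    qed
  next
    have "X \<in> carrier (A[X])" using var_closed(1)[OF sub] .
    moreover have "eval X x = x" using eval_var[OF x(1)] .
    moreover have "?\<phi> X = y"
      using h.hom_one h.hom_zero y(1) by (simp add: var_def)
    ultimately show "g x = y" using tau[of X] by simp
  qed
qed

text \<open>
  The generators are adjoined one at a time. The image under an embedding of the minimal polynomial
  of the next generator has positive degree, hence a root in the algebraically closed ambient field,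
  and that root can serve as the image of the generator.
\<close>

lemma (in algebraically_closed) extend_hom_to_finite_extension:
  assumes A: "subfield A L" and hom: "f \<in> ring_hom (L\<lparr>carrier := A\<rparr>) L"
    and "set xs \<subseteq> carrier L" and "\<And>x. x \<in> set xs \<Longrightarrow> algebraic A x"
  shows "\<exists>g \<in> ring_hom (L\<lparr>carrier := finite_extension A xs\<rparr>) L. \<forall>a \<in> A. g a = f a"
  using assms(3,4)
proof (induction xs)
  case Nil
  then show ?case using hom by auto
next
  case (Cons x xs)
  let ?B = "finite_extension A xs"
  from Cons obtain g where g: "g \<in> ring_hom (L\<lparr>carrier := ?B\<rparr>) L" "\<forall>a \<in> A. g a = f a"
    by auto
  have B: "subfield ?B L"
    using finite_extension_is_subfield[OF A] Cons.prems by (auto simp: over_def)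
  have AB: "A \<subseteq> ?B"
    using finite_extension_incl[OF subfieldE(3)[OF A]] Cons.prems(1) by auto
  have x: "x \<in> carrier L" "algebraic ?B x"
    using algebraic_mono[OF AB, of x] Cons.prems by (auto simp: over_def)
  note irr = Irr_props[OF B x]
  have poly: "map g (Irr ?B x) \<in> carrier (poly_ring L)"
    using polynomial_hom[OF g(1) subfield_iff(2)[OF B] field_axioms, of "Irr ?B x"] irr(1)
      univ_poly_consistent[OF subfieldE(1)[OF B]] by simp
  have "degree (map g (Irr ?B x)) \<ge> 1"
    using pirreducible_degree[OF B irr(1,2)] by simp
  then have "roots (map g (Irr ?B x)) \<noteq> {#}"
    using roots_over_carrier[OF poly] unfolding splitted_def by force
  then obtain y where "y \<in># roots (map g (Irr ?B x))"
    by blast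
  then have "y \<in> carrier L" "eval (map g (Irr ?B x)) y = \<zero>"
    using roots_mem_iff_is_root[OF poly] unfolding is_root_def by blast+
  then obtain k where k: "k \<in> ring_hom (L\<lparr>carrier := simple_extension ?B x\<rparr>) L"
    and kB: "\<And>b. b \<in> ?B \<Longrightarrow> k b = g b"
    using extend_hom_to_simple_extension[OF B g(1) x] by blast
  have "\<forall>a \<in> A. k a = f a"
  proof
    fix a assume "a \<in> A"
    then show "k a = f a" using kB[of a] g(2) AB by (metis subsetD)
  qed
  moreover have "finite_extension A (x # xs) = simple_extension ?B x" by simp
  ultimately show ?case
    using k by metis
qed

lemma (in domain) finite_dimension_imp_finite_extension:
  assumes "subfield A R" and "subfield M R" and "A \<subseteq> M" and "finite_dimension A M"
  obtains xs where "set xs \<subseteq> M" and "M = finite_extension A xs"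
proof -
  obtain Us where Us: "set Us \<subseteq> carrier R" "Span A Us = M"
    using exists_base[OF assms(1) finite_dimensionE[OF assms(1,4)]] by blast
  have UM: "set Us \<subseteq> M"
    using Span_base_incl[OF assms(1) Us(1)] Us(2) by simp
  note sub = subfieldE(1)[OF assms(1)]
  have "subfield (finite_extension A Us) R"
    using finite_extension_is_subfield[OF assms(1) Us(1)] UM
      finite_dimension_imp_algebraic[OF assms(1) subfieldE(1)[OF assms(2)] assms(4)] by blast
  then have "subalgebra A (finite_extension A Us) R"
    using subalgebra_of_subfield finite_extension_incl[OF subfieldE(3)[OF assms(1)] Us(1)] by blast
  then have "M \<subseteq> finite_extension A Us"
    using subalgebra_Span_incl[OF assms(1)] finite_extension_mem[OF sub Us(1)] Us(2) by blast
  moreover have "finite_extension A Us \<subseteq> M"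
    using finite_extension_subring_incl[OF subfieldE(1)[OF assms(2)] assms(3) UM] .
  ultimately show thesis using that UM by blast
qed

lemma (in algebraically_closed) extend_hom:
  assumes "subfield A L" and "subfield M L" and "A \<subseteq> M" and "finite_dimension A M"
    and "f \<in> ring_hom (L\<lparr>carrier := A\<rparr>) L"
  obtains g where "g \<in> ring_hom (L\<lparr>carrier := M\<rparr>) L" and "\<And>a. a \<in> A \<Longrightarrow> g a = f a"
proof -
  obtain xs where "set xs \<subseteq> M" "M = finite_extension A xs"
    using finite_dimension_imp_finite_extension[OF assms(1-4)] .
  then show thesis
    using extend_hom_to_finite_extension[OF assms(1,5), of xs] that subfieldE(3)[OF assms(2)]
      finite_extension_algebraic[OF assms(1,2,4)] by blast
qed

text \<open>
  This makes it possible to check on generators that an embedding maps a field into another one.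
\<close>

lemma (in field) subfield_vimage_hom:
  assumes M: "subfield M R" and g: "g \<in> ring_hom (R\<lparr>carrier := M\<rparr>) R" and N: "subfield N R"
  shows "subfield {m \<in> M. g m \<in> N} R"
proof -
  interpret g: ring_hom_ring "R\<lparr>carrier := M\<rparr>" R g
    using ring_hom_ringI2[OF subring_is_ring[OF subfieldE(1)[OF M]] ring_axioms g] .
  note Mr = subringE[OF subfieldE(1)[OF M]] and Nr = subringE[OF subfieldE(1)[OF N]]
  have mult: "g (a \<otimes> b) = g a \<otimes> g b" if "a \<in> M" "b \<in> M" for a b
    using g.hom_mult[of a b] that by simp
  have add: "g (a \<oplus> b) = g a \<oplus> g b" if "a \<in> M" "b \<in> M" for a b
    using g.hom_add[of a b] that by simp
  have one: "g \<one> = \<one>" using g.hom_one by simp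
  have neg: "g (\<ominus> a) = \<ominus> g a" if "a \<in> M" for a
  proof -
    have "g (\<ominus> a) \<oplus> g a = \<zero>"
      using add[of "\<ominus> a" a] that Mr(1,5) g.hom_zero l_neg[of a] by auto
    then show ?thesis
      using minus_equality g.hom_closed[of a] g.hom_closed[of "\<ominus> a"] that Mr(5) by simp
  qed
  have inv: "g (inv a) \<in> N" if a: "a \<in> M" "g a \<in> N" "a \<noteq> \<zero>" for a
  proof -
    have i: "inv a \<in> M" "a \<otimes> inv a = \<one>"
      using subfield_m_inv[OF M, of a] a by auto
    then have e: "g a \<otimes> g (inv a) = \<one>" using mult[OF a(1) i(1)] one by simp
    have c: "g a \<in> carrier R" "g (inv a) \<in> carrier R" using g.hom_closed a i by auto
    have "g a \<noteq> \<zero>" using e c by auto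
    then have "inv (g a) \<in> N" using subfield_m_inv[OF N, of "g a"] a by auto
    moreover have "inv (g a) = g (inv a)" using comm_inv_char[OF c e] .
    ultimately show ?thesis by simp
  qed
  show ?thesis
  proof (rule subfieldI'[OF subringI])
    show "{m \<in> M. g m \<in> N} \<subseteq> carrier R" using Mr(1) by blast
    show "\<one> \<in> {m \<in> M. g m \<in> N}" using one Mr(3) Nr(3) by simp
  qed (use mult add neg inv Mr Nr subfield_m_inv[OF M] in auto)
qed

section \<open>Normal extensions\<close>

text \<open>
  Let \<open>M\<close> be the generated field and let \<open>y\<close> be conjugate over \<open>E\<close> to \<open>x \<in> M\<close>. The embedding of \<open>E(x)\<close>
  over \<open>E\<close> that sends \<open>x\<close> to \<open>y\<close> extends to an embedding \<open>g\<close> of \<open>M\<close>. As \<open>g\<close> fixes \<open>E\<close>, it maps every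
  generator \<open>s \<in> S\<close> to a conjugate of \<open>s\<close>, which lies in \<open>M\<close> by hypothesis.
  So \<open>g\<close> maps \<open>M\<close> into itself, and \<open>y = g x \<in> M\<close>.
\<close>

lemma (in algebraically_closed) normal_ext_generated_by_conjugates:
  assumes E: "subfield E L" and S: "S \<subseteq> carrier L"
    and fin: "finite_dimension E (generate_field L (E \<union> S))"
    and conj: "\<And>s. s \<in> S \<Longrightarrow> set_mset (roots (Irr E s)) \<subseteq> generate_field L (E \<union> S)"
  shows "normal_ext E (generate_field L (E \<union> S))"
proof -
  let ?M = "generate_field L (E \<union> S)"
  have ES: "E \<union> S \<subseteq> carrier L" using subfieldE(3)[OF E] S by blast
  have M: "subfield ?M L" and ESM: "E \<union> S \<subseteq> ?M"
    using generate_fieldE(1,2)[OF ES refl] by blast+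
  have EM: "E \<subseteq> ?M" using ESM by blast
  have Mc: "?M \<subseteq> carrier L" using subfieldE(3)[OF M] .
  note alg = finite_extension_algebraic[OF E M fin]
  show ?thesis
    unfolding normal_ext_def
  proof (intro ballI subsetI)
    fix x y assume x: "x \<in> ?M" and y: "y \<in># roots (Irr E x)"
    have xc: "x \<in> carrier L" using x Mc by blast
    have y': "y \<in> carrier L" "eval (Irr E x) y = \<zero>"
      using roots_Irr_iff[OF E xc alg[OF x]] y by blast+
    have id: "(\<lambda>a. a) \<in> ring_hom (L\<lparr>carrier := E\<rparr>) L"
      using subfieldE(3)[OF E] by (auto intro!: ring_hom_memI)
    obtain f where f: "f \<in> ring_hom (L\<lparr>carrier := simple_extension E x\<rparr>) L"
      "\<And>a. a \<in> E \<Longrightarrow> f a = a" "f x = y"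
      using extend_hom_to_simple_extension[OF E id xc alg[OF x] y'(1)] y'(2) by auto
    let ?B = "simple_extension E x"
    have B: "subfield ?B L" using simple_extension_is_subfield[OF E xc] alg[OF x]
      by (simp add: over_def)
    have EB: "E \<subseteq> ?B" using simple_extension_incl[OF subfieldE(3)[OF E] xc] .
    have BM: "?B \<subseteq> ?M" using simple_extension_subring_incl[OF subfieldE(1)[OF M] EM x] .
    have xB: "x \<in> ?B" using simple_extension_mem[OF subfieldE(1)[OF E] xc] .
    obtain g where g: "g \<in> ring_hom (L\<lparr>carrier := ?M\<rparr>) L" "\<And>a. a \<in> ?B \<Longrightarrow> g a = f a"
      using extend_hom[OF B M BM finite_dimension_enlarge_base[OF E M fin B EB BM] f(1)]
      by blast
    have gE: "g a = a" if "a \<in> E" for a using g(2) f(2) that EB by auto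
    interpret g: ring_hom_ring "L\<lparr>carrier := ?M\<rparr>" L g
      using ring_hom_ringI2[OF subring_is_ring[OF subfieldE(1)[OF M]] ring_axioms g(1)] .
    have "g s \<in> ?M" if s: "s \<in> S" for s
    proof -
      have sM: "s \<in> ?M" and sc: "s \<in> carrier L" using s ESM S by blast+
      note irr = Irr_props[OF E sc alg[OF sM]]
      have set: "set (Irr E s) \<subseteq> E"
        using irr(1) unfolding sym[OF univ_poly_carrier] polynomial_def by auto
      then have "map g (Irr E s) = Irr E s"
        using gE by (auto intro!: map_idI)
      moreover have "g (eval (Irr E s) s) = eval (map g (Irr E s)) (g s)"
        using g.eval_hom'[of s "Irr E s"] sM set EM eval_consistent[OF subfieldE(1)[OF M]] by auto
      ultimately have "eval (Irr E s) (g s) = \<zero>"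
        using irr(4) g.hom_zero by simp
      then have "g s \<in># roots (Irr E s)"
        using roots_Irr_iff[OF E sc alg[OF sM]] g.hom_closed[of s] sM by simp
      then show ?thesis using conj[OF s] by blast
    qed
    then have "E \<union> S \<subseteq> {m \<in> ?M. g m \<in> ?M}"
      using gE ESM by auto
    then have "?M \<subseteq> {m \<in> ?M. g m \<in> ?M}"
      using generate_field_min_subfield1[OF ES subfield_vimage_hom[OF M g(1) M]] by blast
    then show "y \<in> ?M"
      using x g(2)[OF xB] f(3) by auto
  qed
qed

section \<open>Intersecting the bases of Galois extensions\<close>

lemma (in domain) roots_Irr_separable:
  assumes "subfield K R" and "x \<in> carrier R" and "algebraic K x" and "separable_poly (Irr K x)"
  shows "roots (Irr K x) = mset_set (set_mset (roots (Irr K x)))"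
proof (rule multiset_eqI)
  fix y
  have "count (roots (Irr K x)) y \<le> 1"
    using assms(4) separable_poly_iff[OF Irr_props(5)[OF assms(1-3)]] by blast
  then show "count (roots (Irr K x)) y = count (mset_set (set_mset (roots (Irr K x)))) y"
    by (cases "y \<in># roots (Irr K x)")
      (simp_all add: not_in_iff le_antisym Suc_le_eq)
qed

text \<open>
  The set \<open>S\<close> is a disjoint union of conjugacy classes over \<open>E\<close>, and the product of the corresponding
  minimal polynomials has exactly the elements of \<open>S\<close> as roots, all of them simple by separability.
\<close>

lemma (in field) monic_poly_with_conjugation_closed_roots:
  assumes E: "subfield E R" and "finite S" and "S \<subseteq> carrier R"
    and "\<And>y. y \<in> S \<Longrightarrow> algebraic E y" and "\<And>y. y \<in> S \<Longrightarrow> separable_poly (Irr E y)"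
    and "\<And>y. y \<in> S \<Longrightarrow> set_mset (roots (Irr E y)) \<subseteq> S"
  shows "\<exists>p \<in> carrier (E[X]). p \<noteq> [] \<and> lead_coeff p = \<one> \<and> roots p = mset_set S"
  using assms(2-)
proof (induction S rule: finite_psubset_induct)
  case (psubset S)
  note shell = carrier_polynomial_shell[OF subfieldE(1)[OF E]]
  show ?case
  proof (cases "S = {}")
    case True
    have "[\<one>] \<in> carrier (E[X])"
      using subringE(3)[OF subfieldE(1)[OF E]] unfolding sym[OF univ_poly_carrier] polynomial_def by simp
    moreover have "roots [\<one>] = {#}"
      using degree_zero_imp_empty_roots[OF shell] calculation by simp
    ultimately show ?thesis using True by (intro bexI[of _ "[\<one>]"]) simp_all
  next
    case False
    then obtain y where y: "y \<in> S" by blast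
    have yc: "y \<in> carrier R" and alg: "algebraic E y" using y psubset.prems by auto
    note irr = Irr_props[OF E yc alg]
    define C where "C = set_mset (roots (Irr E y))"
    have CS: "C \<subseteq> S" using psubset.prems(4)[OF y] unfolding C_def .
    have yC: "y \<in> C" using roots_Irr_iff[OF E yc alg] yc irr(4) unfolding C_def by simp
    have rC: "roots (Irr E y) = mset_set C"
      using roots_Irr_separable[OF E yc alg psubset.prems(3)[OF y]] unfolding C_def .
    \<comment> \<open>Conjugacy classes are disjoint, so \<open>S - C\<close> is again closed under conjugation.\<close>
    have "set_mset (roots (Irr E z)) \<subseteq> S - C" if z: "z \<in> S - C" for z
    proof -
      have zc: "z \<in> carrier R" "algebraic E z" using z psubset.prems by auto
      have "w \<notin> C" if w: "w \<in># roots (Irr E z)" for w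
      proof
        assume "w \<in> C"
        then have "Irr E z = Irr E y"
          using Irr_conjugate(2)[OF E yc alg] Irr_conjugate(2)[OF E zc w] unfolding C_def by simp
        then have "z \<in> C"
          using roots_Irr_iff[OF E zc] Irr_props(4)[OF E zc] zc(1) unfolding C_def by simp
        then show False using z by blast
      qed
      then show ?thesis using psubset.prems(4)[of z] z by blast
    qed
    moreover have "S - C \<subset> S" using y yC by blast
    ultimately have "\<exists>p \<in> carrier (E[X]). p \<noteq> [] \<and> lead_coeff p = \<one> \<and> roots p = mset_set (S - C)"
      using psubset.prems by (intro psubset.IH) auto
    then obtain p where p: "p \<in> carrier (E[X])" "p \<noteq> []" "lead_coeff p = \<one>"
      "roots p = mset_set (S - C)" by blast
    define q where "q = poly_mult (Irr E y) p"
    have pol: "polynomial E (Irr E y)" "polynomial E p"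
      using p(1) irr(1) univ_poly_carrier by auto
    have "q \<in> carrier (E[X])"
      using poly_mult_closed[OF subfieldE(1)[OF E] pol] univ_poly_carrier unfolding q_def by blast
    moreover have "q \<noteq> []"
      using poly_mult_integral[OF subfieldE(1)[OF E] pol] irr(6) p(2) unfolding q_def by blast
    moreover have "lead_coeff q = \<one>"
      using poly_mult_lead_coeff[OF subfieldE(1)[OF E] pol irr(6) p(2)] irr(3) p(3)
      unfolding q_def by simp
    moreover have "roots q = roots (Irr E y) + roots p"
      using field.associated_polynomials_imp_same_roots[OF field_axioms irr(5,6) shell[OF p(1)] p(2)]
      unfolding q_def univ_poly_mult .
    moreover have "mset_set C + mset_set (S - C) = mset_set S"
      using mset_set_Union[of C "S - C"] CS psubset.hyps finite_subset[OF CS]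
      by (simp add: Un_absorb1)
    ultimately show ?thesis using rC p(4) by metis
  qed
qed

text \<open>
  The leading terms cancel in the difference, which then has more roots than its degree allows.
\<close>

lemma (in field) polys_eq_if_same_lead_coeff_and_roots:
  assumes p: "p \<in> carrier (poly_ring R)" "p \<noteq> []" and q: "q \<in> carrier (poly_ring R)" "q \<noteq> []"
    and lead: "lead_coeff p = lead_coeff q" and deg: "degree p = degree q"
    and S: "finite S" "S \<subseteq> carrier R" "degree p \<le> card S"
    and roots: "\<And>y. y \<in> S \<Longrightarrow> eval p y = \<zero>" "\<And>y. y \<in> S \<Longrightarrow> eval q y = \<zero>"
  shows "p = q"
proof -
  interpret UP: domain "poly_ring R" using univ_poly_is_domain[OF carrier_is_subring] .
  let ?d = "p \<ominus>\<^bsub>poly_ring R\<^esub> q"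
  have d: "?d \<in> carrier (poly_ring R)" using UP.minus_closed[OF p(1) q(1)] .
  have mq: "\<ominus>\<^bsub>poly_ring R\<^esub> q = map (\<lambda>a. \<ominus> a) q"
    using univ_poly_a_inv_def'[OF carrier_is_subring q(1)] .
  have d_eq: "?d = poly_add p (map (\<lambda>a. \<ominus> a) q)"
    unfolding a_minus_def mq univ_poly_add ..
  have sets: "set p \<subseteq> carrier R" "set q \<subseteq> carrier R" "set (map (\<lambda>a. \<ominus> a) q) \<subseteq> carrier R"
    using p q unfolding sym[OF univ_poly_carrier] polynomial_def by auto
  have "?d = []"
  proof (rule ccontr)
    assume nz: "?d \<noteq> []"
    have le: "degree ?d \<le> degree p"
      unfolding d_eq using poly_add_degree[of p "map (\<lambda>a. \<ominus> a) q"] deg by simp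
    have "coeff ?d (degree p) = coeff p (degree p) \<oplus> coeff (map (\<lambda>a. \<ominus> a) q) (degree p)"
      unfolding d_eq poly_add_coeff[OF sets(1,3)] ..
    also have "\<dots> = lead_coeff p \<oplus> lead_coeff (map (\<lambda>a. \<ominus> a) q)"
      using lead_coeff_simp[OF p(2)] lead_coeff_simp[of "map (\<lambda>a. \<ominus> a) q"] q(2) deg by simp
    also have "\<dots> = \<zero>"
      using lead q(2) sets(2) by (simp add: hd_map r_neg subset_iff)
    finally have "coeff ?d (degree p) = \<zero>" .
    moreover have "lead_coeff ?d \<noteq> \<zero>"
      using d nz unfolding sym[OF univ_poly_carrier] polynomial_def by blast
    ultimately have lt: "degree ?d < degree p"
      using le lead_coeff_simp[OF nz] by (metis le_neq_implies_less)
    have "y \<in># local.roots ?d" if y: "y \<in> S" for y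
    proof -
      have yc: "y \<in> carrier R" using y S(2) by blast
      interpret ev: ring_hom_ring "poly_ring R" R "\<lambda>p. eval p y"
        using eval_ring_hom[OF carrier_is_subring yc] .
      have "eval ?d y = \<zero>"
        using roots[OF y] p(1) q(1) unfolding a_minus_def by simp
      then show ?thesis
        using roots_mem_iff_is_root[OF d] nz yc unfolding is_root_def by blast
    qed
    then have "card S \<le> card (set_mset (local.roots ?d))"
      by (intro card_mono) auto
    also have "\<dots> \<le> size (local.roots ?d)"
      by (simp add: size_multiset_overloaded_eq sum_mono[where f = "\<lambda>_. 1::nat", simplified] Suc_le_eq)
    also have "\<dots> \<le> degree ?d" using size_roots_le_degree[OF d] .
    finally show False using lt S(3) by simp
  qed
  then show "p = q"
    using UP.r_right_minus_eq[OF p(1) q(1)] by (simp add: univ_poly_zero)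
qed

text \<open>
  For \<open>x \<in> M\<close> let \<open>S\<close> be the set of those conjugates of \<open>x\<close> over \<open>E\<^sub>1 \<inter> E\<^sub>2\<close> that lie in \<open>M\<close>. Because \<open>M\<close> is
  normal over \<open>E\<^sub>1\<close> and over \<open>E\<^sub>2\<close>, the set \<open>S\<close> is closed under conjugation over either field. So the
  monic polynomial with simple roots \<open>S\<close> has its coefficients in \<open>E\<^sub>1\<close> and in \<open>E\<^sub>2\<close>, hence in
  \<open>E\<^sub>1 \<inter> E\<^sub>2\<close>. It vanishes at \<open>x\<close>, so the minimal polynomial of \<open>x\<close> divides it: all conjugates
  of \<open>x\<close> lie in \<open>S \<subseteq> M\<close>, and they are simple roots.
\<close>

lemma (in algebraically_closed) galois_ext_Int:
  assumes g1: "galois_ext E\<^sub>1 M" and g2: "galois_ext E\<^sub>2 M" 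
    and fin: "finite_dimension (E\<^sub>1 \<inter> E\<^sub>2) M"
  shows "galois_ext (E\<^sub>1 \<inter> E\<^sub>2) M"
proof -
  let ?E = "E\<^sub>1 \<inter> E\<^sub>2"
  have M: "subfield M L" using g1 unfolding galois_ext_def finite_field_ext_def by blast
  have E12: "subfield E\<^sub>1 L" "subfield E\<^sub>2 L" "E\<^sub>1 \<subseteq> M" 
    using g1 g2 unfolding galois_ext_def finite_field_ext_def by blast+
  have E: "subfield ?E L" using subfield_Int[OF E12(1,2)] .
  have Mc: "M \<subseteq> carrier L" using subfieldE(3)[OF M] .
  note algE = finite_extension_algebraic[OF E M fin]
  have key: "\<exists>S \<subseteq> M. finite S \<and> roots (Irr ?E x) \<subseteq># mset_set S" if x: "x \<in> M" for x
  proof -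
    have xc: "x \<in> carrier L" using x Mc by blast
    note irr = Irr_props[OF E xc algE[OF x]]
    define S where "S = M \<inter> set_mset (roots (Irr ?E x))"
    have S: "finite S" "S \<subseteq> carrier L" "S \<subseteq> M" unfolding S_def using Mc by auto
    have xS: "x \<in> S"
      unfolding S_def using x roots_Irr_iff[OF E xc algE[OF x]] irr(4) xc by simp
    have ex: "\<exists>p \<in> carrier (F[X]). p \<noteq> [] \<and> lead_coeff p = \<one> \<and> roots p = mset_set S"
      if F: "?E \<subseteq> F" "galois_ext F M" for F
    proof (rule monic_poly_with_conjugation_closed_roots[OF _ S(1,2)])
      have FM: "normal_ext F M" "separable_ext F M" "finite_dimension F M"
        using F(2) unfolding galois_ext_def finite_field_ext_def by blast+
      show sF: "subfield F L" using F(2) unfolding galois_ext_def finite_field_ext_def by blast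
      fix y assume y: "y \<in> S"
      have yM: "y \<in> M" and yr: "y \<in># roots (Irr ?E x)" using y unfolding S_def by blast+
      show "algebraic F y" using finite_extension_algebraic[OF sF M FM(3) yM] .
      show "separable_poly (Irr F y)" using FM(2) yM unfolding separable_ext_def by blast
      have "roots (Irr F y) \<subseteq># roots (Irr ?E y)"
        using roots_Irr_antimono[OF E sF F(1) _ algE[OF yM]] yM Mc by blast
      also have "Irr ?E y = Irr ?E x" using Irr_conjugate(2)[OF E xc algE[OF x] yr] .
      finally show "set_mset (roots (Irr F y)) \<subseteq> S"
        using FM(1) yM set_mset_mono unfolding normal_ext_def S_def by blast
    qed
    obtain p where p: "p \<in> carrier (E\<^sub>1[X])" "p \<noteq> []" "lead_coeff p = \<one>" "roots p = mset_set S"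
      using ex[OF _ g1] by blast
    obtain q where q: "q \<in> carrier (E\<^sub>2[X])" "q \<noteq> []" "lead_coeff q = \<one>" "roots q = mset_set S"
      using ex[OF _ g2] by blast
    have pq: "p \<in> carrier (poly_ring L)" "q \<in> carrier (poly_ring L)"
      using carrier_polynomial_shell subfieldE(1) E12 p(1) q(1) by blast+
    have deg: "degree p = card S" "degree q = card S"
      using roots_over_carrier[OF pq(1)] roots_over_carrier[OF pq(2)] p(4) q(4)
      unfolding splitted_def by simp_all
    have root: "eval p y = \<zero>" "eval q y = \<zero>" if "y \<in> S" for y
      using roots_mem_iff_is_root[OF pq(1), of y] roots_mem_iff_is_root[OF pq(2), of y] p(4) q(4) that S(1)
      unfolding is_root_def by simp_all
    have "p = q"
      using polys_eq_if_same_lead_coeff_and_roots[OF pq(1) p(2) pq(2) q(2)] p(3) q(3) deg S(1,2) root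
      by simp
    then have "p \<in> carrier (?E[X])"
      using p(1) q(1) unfolding sym[OF univ_poly_carrier] polynomial_def by auto
    then have "Irr ?E x pdivides p"
      using Irr_minimal[OF E xc] algE[OF x] root(1)[OF xS] by (simp add: over_def)
    then have "roots (Irr ?E x) \<subseteq># roots p"
      using pdivides_imp_roots_incl[OF irr(5) pq(1) p(2)] by blast
    then show ?thesis using p(4) S by auto
  qed
  have "normal_ext ?E M"
    unfolding normal_ext_def
  proof
    fix x assume "x \<in> M"
    from key[OF this] show "set_mset (roots (Irr ?E x)) \<subseteq> M"
      by (metis finite_set_mset_mset_set order_trans set_mset_mono)
  qed
  moreover have "separable_ext ?E M"
    unfolding separable_ext_def
  proof
    fix x assume x: "x \<in> M"
    then obtain S where S: "roots (Irr ?E x) \<subseteq># mset_set S" using key by blast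
    have "count (roots (Irr ?E x)) y \<le> 1" for y
      using mset_subset_eq_count[OF S, of y] count_mset_set'[of S y] by (simp split: if_splits)
    then show "separable_poly (Irr ?E x)"
      using separable_poly_iff[OF Irr_props(5)[OF E _ algE[OF x]]] x Mc by blast
  qed
  ultimately show ?thesis
    using E M E12(3) fin unfolding galois_ext_def finite_field_ext_def by blast
qed

section \<open>Galois extensions from composita\<close>

text \<open>
  The common source of the two facts on composita below. Conjugation is taken over the small field
  \<open>K\<close>, where \<open>S\<close> is known to be closed, while the base of the resulting Galois extension may be any
  larger field \<open>E\<close>.
\<close>

lemma (in algebraically_closed) galois_ext_generated:
  assumes K: "perfect_field K" and fin: "finite_dimension K (generate_field L (E \<union> S))"
    and E: "subfield E L" "K \<subseteq> E" and S: "S \<subseteq> carrier L"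
    and conj: "\<And>s. s \<in> S \<Longrightarrow> set_mset (roots (Irr K s)) \<subseteq> S"
  shows "galois_ext E (generate_field L (E \<union> S))"
proof -
  let ?M = "generate_field L (E \<union> S)"
  have sK: "subfield K L" using K unfolding perfect_field_def by blast
  have ES: "E \<union> S \<subseteq> carrier L" using subfieldE(3)[OF E(1)] S by blast
  have M: "subfield ?M L" and ESM: "E \<union> S \<subseteq> ?M"
    using generate_fieldE(1,2)[OF ES refl] by blast+
  then have EM: "E \<subseteq> ?M" and SM: "S \<subseteq> ?M" by blast+
  have finE: "finite_dimension E ?M"
    using finite_dimension_enlarge_base[OF sK M fin E EM] .
  have "normal_ext E ?M"
  proof (rule normal_ext_generated_by_conjugates[OF E(1) S finE])
    fix s assume s: "s \<in> S"
    have sc: "s \<in> carrier L" using s S by blast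
    have "algebraic K s" using finite_extension_algebraic[OF sK M fin] s SM by blast
    then have "set_mset (roots (Irr E s)) \<subseteq> set_mset (roots (Irr K s))"
      using set_mset_mono[OF roots_Irr_antimono[OF sK E sc]] by blast
    then show "set_mset (roots (Irr E s)) \<subseteq> ?M" using conj[OF s] SM by blast
  qed
  then show ?thesis
    using perfect_field_separable_ext[OF K M fin E EM] E(1) M EM finE
    unfolding galois_ext_def finite_field_ext_def by blast
qed

lemma (in algebraically_closed) galois_ext_compositum_base_change:
  assumes "perfect_field K" and "finite_dimension K (compositum E F)"
    and "subfield E L" and "K \<subseteq> E" and F: "galois_ext K F"
  shows "galois_ext E (compositum E F)"
  unfolding compositum_def
proof (rule galois_ext_generated[OF assms(1) _ assms(3,4)])
  show "F \<subseteq> carrier L"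
    using F subfieldE(3) unfolding galois_ext_def finite_field_ext_def by blast
  show "set_mset (roots (Irr K s)) \<subseteq> F" if "s \<in> F" for s
    using F that unfolding galois_ext_def normal_ext_def by blast
qed (use assms(2) in \<open>simp add: compositum_def\<close>)

text \<open>
  A union of two conjugation-closed sets is conjugation-closed.
\<close>

lemma (in algebraically_closed) galois_ext_compositum:
  assumes K: "perfect_field K" and fin: "finite_dimension K (compositum E F)"
    and E: "galois_ext K E" and F: "galois_ext K F"
  shows "galois_ext K (compositum E F)"
proof -
  have sub: "K \<subseteq> E" "E \<subseteq> carrier L" "F \<subseteq> carrier L" "subfield K L"
    using E F subfieldE(3) unfolding galois_ext_def finite_field_ext_def by blast+
  have eq: "compositum E F = generate_field L (K \<union> (E \<union> F))"
    using sub(1) unfolding compositum_def by (simp add: Un_absorb1 flip: Un_assoc)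
  show ?thesis
    unfolding eq
  proof (rule galois_ext_generated[OF K fin[unfolded eq] sub(4) subset_refl])
    show "E \<union> F \<subseteq> carrier L" using sub by blast
    show "set_mset (roots (Irr K s)) \<subseteq> E \<union> F" if "s \<in> E \<union> F" for s
      using E F that unfolding galois_ext_def normal_ext_def by blast
  qed
qed

section \<open>The first steps of the two chains\<close>

lemma (in ring) dim_le_dim:
  assumes "subfield K R" and "subfield E R" and "subfield M R"
    and "K \<subseteq> E" and "E \<subseteq> M" and "finite_dimension K M"
  shows "dim E M \<le> dim K M" and "dim K E \<le> dim K M"
proof -
  have fin: "finite_dimension K E" "finite_dimension E M"
    using finite_dimension_subfield[OF assms(1,6,2,4,5)]
      finite_dimension_enlarge_base[OF assms(1,3,6,2,4,5)] by blast+
  \<comment> \<open>A field contains \<open>\<one> \<noteq> \<zero>\<close>, so its degree over a subfield is not zero.\<close>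
  have pos: "dim A B > 0" if "subfield A R" "subfield B R" "finite_dimension A B" for A B
  proof (rule ccontr)
    assume "\<not> dim A B > 0"
    then have "dimension 0 A B"
      using finite_dimensionE[OF that(1,3)] by (simp add: over_def)
    then have "B = {\<zero>}" using dimension_zero[OF that(1)] by blast
    then show False using subfieldE(6)[OF that(2)] subringE(3)[OF subfieldE(1)[OF that(2)]] by blast
  qed
  have "dim K M = dim K E * dim E M"
    using telescopic_base_dim(2)[OF assms(1,2) fin] by (simp add: over_def)
  then show "dim E M \<le> dim K M" "dim K E \<le> dim K M"
    using pos[OF assms(1,2) fin(1)] pos[OF assms(2,3) fin(2)] by auto
qed

lemma is_arg_max_if_ge:
  fixes f :: "'a \<Rightarrow> 'b::linorder"
  assumes "is_arg_max f P x" and "P y" and "f x \<le> f y"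
  shows "is_arg_max f P y"
  using assms(2) is_arg_max_linorder[THEN iffD1, OF assms(1)] assms(3)
  unfolding is_arg_max_linorder by (blast intro: order_trans)

text \<open>
  Maximality of the degree makes \<open>N\<close> not merely a minimal but the least base over which \<open>M\<close> is Galois:
  \<open>M\<close> is Galois over \<open>N \<inter> E\<close>, of at least the same degree, so uniqueness of the maximizer gives
  \<open>N \<inter> E = N\<close>.
\<close>

lemma (in algebraically_closed) descending_step_least:
  assumes step: "descending_step K M N" and fin: "finite_field_ext K M"
    and E: "intermediate_field K M E" "galois_ext E M"
  shows "N \<subseteq> E"
proof -
  let ?P = "\<lambda>E. intermediate_field K M E \<and> galois_ext E M"
  have max: "is_arg_max (\<lambda>E. dim E M) ?P N"
    using step unfolding descending_step_def by blast
  then have N: "intermediate_field K M N" "galois_ext N M" unfolding is_arg_max_def by blast+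
  have sub: "subfield K L" "subfield M L" "finite_dimension K M" "subfield N L" "subfield E L"
    "K \<subseteq> N" "K \<subseteq> E" "N \<subseteq> M" "E \<subseteq> M"
    using fin N E unfolding finite_field_ext_def intermediate_field_def by blast+
  have int: "subfield (N \<inter> E) L" using subfield_Int[OF sub(4,5)] .
  have finI: "finite_dimension (N \<inter> E) M"
    using finite_dimension_enlarge_base[OF sub(1-3) int] sub by blast
  have P: "?P (N \<inter> E)"
    using galois_ext_Int[OF N(2) E(2) finI] int sub unfolding intermediate_field_def by blast
  have "dim N M \<le> dim (N \<inter> E) M"
    using dim_le_dim(1)[OF int sub(4,2) _ sub(8) finI] by blast
  then have "is_arg_max (\<lambda>E. dim E M) ?P (N \<inter> E)"
    using is_arg_max_if_ge[OF max P] by blast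
  then have "N \<inter> E = N" using step unfolding descending_step_def by metis
  then show ?thesis by blast
qed

text \<open>
  Dually to the descending case, the compositum of \<open>N\<close> and \<open>F\<close> is a Galois extension of \<open>K\<close> inside \<open>M\<close>
  of at least the same degree as \<open>N\<close>, hence equal to \<open>N\<close>.
\<close>

lemma (in algebraically_closed) ascending_step_greatest:
  assumes step: "ascending_step K M N" and K: "perfect_field K" and fin: "finite_field_ext K M"
    and F: "galois_ext K F" "F \<subseteq> M"
  shows "F \<subseteq> N"
proof -
  let ?P = "\<lambda>E. intermediate_field K M E \<and> galois_ext K E"
  have max: "is_arg_max (\<lambda>E. dim K E) ?P N"
    using step unfolding ascending_step_def by blast
  then have N: "intermediate_field K M N" "galois_ext K N" unfolding is_arg_max_def by blast+
  have sub: "subfield K L" "subfield M L" "finite_dimension K M" "subfield N L" "subfield F L"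
    "K \<subseteq> N" "K \<subseteq> F" "N \<subseteq> M"
    using fin N F unfolding finite_field_ext_def intermediate_field_def galois_ext_def by blast+
  have NF: "N \<union> F \<subseteq> carrier L" using subfieldE(3) sub(4,5) by blast
  let ?C = "compositum N F"
  have C: "subfield ?C L" "N \<union> F \<subseteq> ?C" "?C \<subseteq> M"
    using generate_fieldE(1,2)[OF NF refl] generate_field_min_subfield1[OF NF sub(2)] sub(8) F(2)
    unfolding compositum_def by blast+
  have finC: "finite_dimension K ?C"
    using finite_dimension_subfield[OF sub(1,3) C(1) _ C(3)] C(2) sub(6) by blast
  have P: "?P ?C"
    using galois_ext_compositum[OF K finC N(2) F(1)] C sub(6) unfolding intermediate_field_def by blast
  have "dim K N \<le> dim K ?C"
    using dim_le_dim(2)[OF sub(1,4) C(1) sub(6) _ finC] C(2) by blast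
  then have "is_arg_max (\<lambda>E. dim K E) ?P ?C"
    using is_arg_max_if_ge[OF max P] by blast
  then have "?C = N" using step unfolding ascending_step_def by metis
  then show ?thesis using C(2) by blast
qed

text \<open>
  Along a chain whose steps are monotone, every member after the first is bounded by the second one.
  This transfers the bound on the first step of either chain to its later members.
\<close>

lemma successively_obtain_second:
  assumes "successively P (x # xs)" and "y \<in> set xs"
    and "\<And>u v. P u v \<Longrightarrow> R u v" and "reflp R" and "transp R"
  obtains z where "P x z" and "R z y"
proof (cases xs)
  case Nil
  then show thesis using assms(2) by simp
next
  case (Cons z zs)
  have "successively R xs"
    using assms(1,3) Cons successively_mono[of P xs R] by (simp add: successively_Cons)
  then have "sorted_wrt R xs"
    using assms(5) successively_conv_sorted_wrt by blast
  then have "R z y"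
    using assms(2,4) Cons reflpD by fastforce
  moreover have "P x z" using assms(1) Cons by simp
  ultimately show thesis using that by blast
qed

text \<open>
  The squeeze \<open>F \<subseteq> F' \<subseteq> N \<subseteq> N' \<subseteq> E\<close>, where \<open>N'\<close> and \<open>F'\<close> are the second fields of the descending and
  of the ascending chain. The conditions \<open>N \<noteq> M\<close> and \<open>N \<noteq> K\<close> ensure that \<open>N\<close> is not the first
  field of its chain.
\<close>

lemma (in algebraically_closed) common_chain_field_imp_subset:
  assumes K: "perfect_field K" and fin: "finite_field_ext K M"
    and desc: "unique_descending_chain K M Ns" and asc: "unique_ascending_chain K M Fs"
    and N: "N \<in> set Ns" "N \<noteq> M" "N \<noteq> K" "N \<in> set Fs"
    and E: "intermediate_field K M E" and F: "galois_ext K F" and M: "compositum E F = M"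
  shows "F \<subseteq> E"
proof -
  have sub: "subfield K L" "subfield M L" "finite_dimension K M" "subfield E L" "K \<subseteq> E"
    "subfield F L"
    using fin E F unfolding finite_field_ext_def intermediate_field_def galois_ext_def by blast+
  have "E \<union> F \<subseteq> carrier L" using sub(4,6) subfieldE(3) by blast
  then have FM: "F \<subseteq> M"
    using generate_fieldE(2) M unfolding compositum_def by blast
  have ME: "galois_ext E M"
    using galois_ext_compositum_base_change[OF K _ sub(4,5) F] M sub(3) by simp
  obtain Ns' where Ns: "Ns = M # Ns'" 
    using desc unfolding unique_descending_chain_def by (cases Ns) auto
  obtain Fs' where Fs: "Fs = K # Fs'" 
    using asc unfolding unique_ascending_chain_def by (cases Fs) auto
  obtain N' where N': "descending_step K M N'" "N \<subseteq> N'"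
  proof (rule successively_obtain_second[of "\<lambda>M N. N \<subset> M \<and> descending_step K M N" M Ns' N "(\<supseteq>)"])
    show "successively (\<lambda>M N. N \<subset> M \<and> descending_step K M N) (M # Ns')"
      using desc unfolding unique_descending_chain_def Ns by (elim conjE)
    show "N \<in> set Ns'" using N(1,2) Ns by simp
  qed (auto simp: reflp_def transp_def)
  obtain F' where F': "ascending_step K M F'" "F' \<subseteq> N"
  proof (rule successively_obtain_second[of "\<lambda>U V. U \<subset> V \<and> ascending_step U M V" K Fs' N "(\<subseteq>)"])
    show "successively (\<lambda>U V. U \<subset> V \<and> ascending_step U M V) (K # Fs')"
      using asc unfolding unique_ascending_chain_def Fs by (elim conjE)
    show "N \<in> set Fs'" using N(3,4) Fs by simp
  qed (auto simp: reflp_def transp_def)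
  show ?thesis
    using ascending_step_greatest[OF F'(1) K fin F FM] F'(2) N'(2)
      descending_step_least[OF N'(1) fin E ME] by blast
qed

theorem theorem2p4:
  fixes \<Omega> :: "('a, 'b) ring_scheme" (structure)
    and K L N :: "'a set" and Ns Fs :: "'a set list"
  assumes "algebraic_closure \<Omega> K"
    and "ring.perfect_field \<Omega> K"
    and "ring.finite_field_ext \<Omega> K L" and "L \<noteq> K"
    and "ring.unique_descending_chain \<Omega> K L Ns"
    and "ring.unique_ascending_chain \<Omega> K L Fs"
    and "N \<in> set Ns" and "N \<noteq> L" and "N \<noteq> K"
    and "N \<in> set Fs"
  shows "ring.primitive_ext \<Omega> K L"
proof -
  interpret algebraic_closure \<Omega> K using assms(1) .
  have K: "subfield K \<Omega>" using assms(2) unfolding perfect_field_def by blast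
  have "dim K F = 1" if scm: "strong_cluster_magnification K L E F" for E F
  proof -
    have F: "galois_ext K F" and E: "intermediate_field K L E"
      and disj: "galois_closure K E \<inter> F = K" and comp: "compositum E F = L"
      using scm unfolding strong_cluster_magnification_def by blast+
    have "F \<subseteq> E"
      using common_chain_field_imp_subset[OF assms(2,3,5,6,7-10) E F comp] .
    moreover have "E \<subseteq> galois_closure K E"
      unfolding galois_closure_def by blast
    ultimately have "F = K" using disj by blast
    then show ?thesis
      using dimI[OF K dimension_one[OF K]] by (simp add: over_def)
  qed
  then show ?thesis unfolding primitive_ext_def by blast
qed

end
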